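(* For every prime $p$ fix a primitive root $g(p)$ modulo $p$ (with $g(2)=1$). Then the set $$\mathfrak{P}=\{P : P \text{ is a } \Sigma\text{-pattern with first symbol in } \Sigma,\ |P|_{?}=1,\ \mathrm{T}(P)\text{ is completely additive}\}$$ equals $$\big\{\,\big((\lambda_{p,g(p)}\cdot c)\,\rho_d\big)^{(k)} \;:\; p \text{ prime},\ k\ge 1,\ c,d\in\Sigma,\ \xi(p-1,|\Sigma|)\text{ divides } c\,\big\}\ \cup\ \{\,0^{j}\,?\,0^{l} : j\ge 1,\ l\ge 0\,\}.$$
   Context: $\Sigma=\mathbb{Z}/k\mathbb{Z}=\{0,\dots,k-1\}$ (addition mod $k$) is a fixed finite cyclic group. $\mathrm{S}_\Sigma$ is the group of bijections $\Sigma\to\Sigma$ (assumed disjoint from $\Sigma$); its elements are called gaps, $?$ denotes the identity bijection, and for $d\in\Sigma$, $\rho_d$ denotes the rotation $x\mapsto x+d$. A $\Sigma$-pattern is a nonempty finite word over $\Sigma\cup\mathrm{S}_\Sigma$; $|P|$ is its length and $|P|_?$ its number of gaps (letters in $\mathrm{S}_\Sigma$). For words (finite or infinite) $x,y$ over $\Sigma\cup \mathrm{S}_\Sigma$, $x\langle y\rangle$ fills the gaps of $x$ in order with the letters of $y$: $(a\,x)\langle y\rangle=a\,x\langle y\rangle$, $(f\,x)\langle b\,y\rangle=f(b)\,x\langle y\rangle$, $(f\,x)\langle g\,y\rangle=(f\circ g)\,x\langle y\rangle$, $x\langle\varepsilon\rangle=x$ (for $a,b\in\Sigma$, $f,g\in\mathrm{S}_\Sigma$;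 for finite words one requires the number of gaps of $x$ to equal the length of $y$). For a pattern $P$ whose first symbol lies in $\Sigma$, let $T_0=?^\omega$, $T_{i+1}=P^\omega\langle T_i\rangle$, and $\mathrm{T}(P)=\lim_i T_i$, an infinite word over $\Sigma$ indexed by positive integers (the Toeplitz word generated by $P$). With $\xi(n,m)=m/\gcd(n,m)$, the composition of patterns is $P\circ Q=P$ if $|P|_?=0$, and otherwise $P\circ Q=P^{d_1}\langle Q^{d_2}\rangle$ with $d_1=\xi(|P|_?,|Q|)$, $d_2=\xi(|Q|,|P|_?)$; powers are $P^{(0)}=?$, $P^{(n+1)}=P\circ P^{(n)}$. A sequence $\sigma:\mathbb{Z}_{>0}\to\Sigma$ is completely additive if $\sigma(1)=0$ and $\sigma(nm)=\sigma(n)+\sigma(m)$ for all $n,m\ge1$. For a word $w=w_1\dots w_r$ over $\{0,1,\dots\}$ and $c\in\Sigma$, $w\cdot c$ is the word $(w_1c)\dots(w_rc)$ where $jc=c+\dots+c$ ($j$ times); "$\xi$ divides $c$" means $c=\xi\,c'$ for some $c'\in\Sigma$. For an odd prime $p$ and primitive root $g$ mod $p$, $\lambda_{p,g}=\log_g(1)\log_g(2)\cdots\log_g(p-1)$, where $\log_g(a)\in\{0,\dots,p-2\}$ is the unique $e$ with $g^e\equiv a \pmod p$ (so the first letter is $0$); $\lambda_{2,1}=0$. Convention: whenever $\mathrm{T}(P)$ is not surjective onto $\Sigma$, a gap $f$ occurring in $P$ is identified with every bijection agreeing with $f$ on the letters occurring in $\mathrm{T}(P)$; equalities of patterns are understood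 modulo this identification. *)

theory Defs
  imports
    "HOL-Library.Stream"
    "HOL-Combinatorics.Perm"
    "HOL-Number_Theory.Number_Theory"
    "Berlekamp_Zassenhaus.Finite_Field"
begin

text \<open>
  The alphabet \<open>\<Sigma> = \<int>/k\<int>\<close> is the type \<open>'k mod_ring\<close> with \<open>k = CARD('k) \<ge> 1\<close>. Most notions below
  only need a type \<open>'a\<close> of symbols. On a finite type, \<open>'a perm\<close> consists of all bijections
  \<open>'a \<Rightarrow> 'a\<close>; its multiplication is composition and \<open>1\<close> is the identity, that is, the gap \<open>?\<close>.
\<close>

notation "apply" (infixl \<open>\<langle>$\<rangle>\<close> 999)

datatype 'a letter = Sym 'a | Gap "'a Perm.perm"

type_synonym 'a word = "'a letter list"

abbreviation is_gap :: "'a letter \<Rightarrow> bool" where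
  "is_gap x \<equiv> \<exists>f. x = Gap f"

definition num_gaps :: "'a word \<Rightarrow> nat" where
  "num_gaps P = length (filter is_gap P)"

definition sym_headed_pattern :: "'a word \<Rightarrow> bool" where
  "sym_headed_pattern P \<longleftrightarrow> P \<noteq> [] \<and> (\<exists>a. hd P = Sym a)"

definition rotation :: "'a::{finite, group_add} \<Rightarrow> 'a Perm.perm" where
  "rotation d = Perm (\<lambda>x. x + d)"

lemma apply_rotation: "rotation d \<langle>$\<rangle> x = x + d"
proof -
  have "bij (\<lambda>x. x + d)"
    by (rule bij_plus_right)
  then show ?thesis
    unfolding rotation_def by (subst Perm_inverse) auto
qed


subsection \<open>Filling gaps\<close>

fun subst_gap :: "'a Perm.perm \<Rightarrow> 'a letter \<Rightarrow> 'a letter" where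
  "subst_gap f (Sym b) = Sym (f \<langle>$\<rangle> b)"
| "subst_gap f (Gap g) = Gap (f * g)"

text \<open>The finite version is only meaningful if \<^term>\<open>num_gaps x = length y\<close>.\<close>

fun fill :: "'a word \<Rightarrow> 'a word \<Rightarrow> 'a word" where
  "fill (Sym a # x) y = Sym a # fill x y"
| "fill (Gap f # x) (b # y) = subst_gap f b # fill x y"
| "fill x [] = x"
| "fill [] y = []"

primcorec sfill :: "'a letter stream \<Rightarrow> 'a letter stream \<Rightarrow> 'a letter stream" where
  "shd (sfill x y) = (case shd x of Sym a \<Rightarrow> Sym a | Gap f \<Rightarrow> subst_gap f (shd y))"
| "stl (sfill x y) = sfill (stl x) (case shd x of Sym a \<Rightarrow> y | Gap f \<Rightarrow> stl y)"

lemma sfill_Sym: "sfill (Sym a ## x) y = Sym a ## sfill x y"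
  and sfill_Gap: "sfill (Gap f ## x) (b ## y) = subst_gap f b ## sfill x y"
  by (rule stream.expand, simp, rule stream.expand, simp)


subsection \<open>Toeplitz words\<close>

primrec toeplitz_approx :: "'a word \<Rightarrow> nat \<Rightarrow> 'a letter stream" where
  "toeplitz_approx P 0 = sconst (Gap 1)"
| "toeplitz_approx P (Suc i) = sfill (Stream.cycle P) (toeplitz_approx P i)"

text \<open>
  The limit is taken letter by letter. Infinite words are indexed by the positive integers,
  streams from \<open>0\<close>; the value at \<open>n = 0\<close> is junk and never used.
\<close>

definition toeplitz :: "'a word \<Rightarrow> nat \<Rightarrow> 'a" where
  "toeplitz P n = (THE a. \<forall>\<^sub>F i in sequentially. toeplitz_approx P i !! (n - 1) = Sym a)"

definition completely_additive :: "(nat \<Rightarrow> 'a::monoid_add) \<Rightarrow> bool" where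
  "completely_additive \<sigma> \<longleftrightarrow>
     \<sigma> 1 = 0 \<and> (\<forall>n m. n \<ge> 1 \<longrightarrow> m \<ge> 1 \<longrightarrow> \<sigma> (n * m) = \<sigma> n + \<sigma> m)"

lemma snth_sfill:
  "sfill x y !! n = (case x !! n of Sym a \<Rightarrow> Sym a
     | Gap f \<Rightarrow> subst_gap f (y !! num_gaps (stake n x)))"
proof (induction n arbitrary: x y)
  case (Suc n)
  then show ?case by (cases "shd x") (simp_all add: num_gaps_def split: letter.split)
qed (simp add: num_gaps_def split: letter.split)

lemma num_gaps_stake_cycle_le:
  assumes "sym_headed_pattern P"
  shows "num_gaps (stake n (Stream.cycle P)) \<le> n - 1"
proof (cases n)
  case (Suc m)
  obtain a where "hd P = Sym a"
    using assms by (auto simp: sym_headed_pattern_def)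
  then show ?thesis
    using Suc length_filter_le[of is_gap "stake m (stl (Stream.cycle P))"]
    by (simp add: num_gaps_def)
qed (simp add: num_gaps_def)

lemma num_gaps_stake_cycle_less:
  assumes "sym_headed_pattern P" and "Stream.cycle P !! n = Gap f"
  shows "num_gaps (stake n (Stream.cycle P)) < n"
proof -
  have "n \<noteq> 0"
    using assms by (cases n) (auto simp: sym_headed_pattern_def)
  with num_gaps_stake_cycle_le[OF assms(1), of n] show ?thesis by simp
qed

lemma toeplitz_limit_exists:
  assumes "sym_headed_pattern P"
  shows "\<exists>a. \<forall>\<^sub>F i in sequentially. toeplitz_approx P i !! n = Sym a"
proof (induction n rule: less_induct)
  case (less n)
  show ?case
  proof (cases "Stream.cycle P !! n")
    case (Sym a)
    have "\<forall>\<^sub>F i in sequentially. toeplitz_approx P (Suc i) !! n = Sym a"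
      using Sym by (simp add: snth_sfill)
    then show ?thesis
      by (subst (asm) eventually_sequentially_Suc) blast
  next
    case (Gap f)
    from less[OF num_gaps_stake_cycle_less[OF assms Gap]] obtain a where
      "\<forall>\<^sub>F i in sequentially. toeplitz_approx P i !! num_gaps (stake n (Stream.cycle P)) = Sym a"
      by blast
    then have "\<forall>\<^sub>F i in sequentially. toeplitz_approx P (Suc i) !! n = Sym (f \<langle>$\<rangle> a)"
      by eventually_elim (simp add: snth_sfill Gap)
    then show ?thesis
      by (subst (asm) eventually_sequentially_Suc) blast
  qed
qed

lemma toeplitz_eqI:
  assumes "\<forall>\<^sub>F i in sequentially. toeplitz_approx P i !! n = Sym a"
  shows "toeplitz P (Suc n) = a"
proof -
  have uniq: "b = a" if "\<forall>\<^sub>F i in sequentially. toeplitz_approx P i !! n = Sym b" for b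
  proof -
    have "\<forall>\<^sub>F i::nat in sequentially. b = a"
      using assms that by eventually_elim simp
    then show ?thesis by simp
  qed
  show ?thesis
    unfolding toeplitz_def diff_Suc_1 using assms uniq by (rule the_equality)
qed

lemma toeplitz_is_limit:
  assumes "sym_headed_pattern P"
  shows "\<forall>\<^sub>F i in sequentially. toeplitz_approx P i !! n = Sym (toeplitz P (Suc n))"
proof -
  obtain a where a: "\<forall>\<^sub>F i in sequentially. toeplitz_approx P i !! n = Sym a"
    using toeplitz_limit_exists[OF assms] by blast
  with toeplitz_eqI[OF a] show ?thesis by simp
qed

lemma toeplitz_rec:
  assumes "sym_headed_pattern P"
  shows "toeplitz P (Suc n) = (case Stream.cycle P !! n of Sym a \<Rightarrow> a
     | Gap f \<Rightarrow> f \<langle>$\<rangle> (toeplitz P (Suc (num_gaps (stake n (Stream.cycle P))))))"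
    (is "_ = ?r")
proof -
  have "\<forall>\<^sub>F i in sequentially. toeplitz_approx P (Suc i) !! n = Sym ?r"
    using toeplitz_is_limit[OF assms, of "num_gaps (stake n (Stream.cycle P))"]
    by eventually_elim (simp add: snth_sfill split: letter.split)
  then show ?thesis
    by (subst (asm) eventually_sequentially_Suc) (rule toeplitz_eqI)
qed


subsection \<open>Identification of patterns\<close>

text \<open>
  Gaps are identified if they agree on the letters occurring in the Toeplitz word. If that word is
  surjective onto the alphabet, this is equality.
\<close>

fun same_letter_on :: "'a set \<Rightarrow> 'a letter \<Rightarrow> 'a letter \<Rightarrow> bool" where
  "same_letter_on A (Sym a) (Sym b) \<longleftrightarrow> a = b"
| "same_letter_on A (Gap f) (Gap g) \<longleftrightarrow> (\<forall>a\<in>A. f \<langle>$\<rangle> a = g \<langle>$\<rangle> a)"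
| "same_letter_on A _ _ \<longleftrightarrow> False"

definition toeplitz_letters :: "'a word \<Rightarrow> 'a set" where
  "toeplitz_letters P = toeplitz P ` {1..}"

definition identified :: "('a word \<times> 'a word) set" where
  "identified = {(P, Q). sym_headed_pattern P \<and> sym_headed_pattern Q \<and>
     list_all2 (same_letter_on (toeplitz_letters P)) P Q}"

lemma same_letter_on_refl: "same_letter_on A x x"
  by (cases x) simp_all

lemma same_letter_on_sym: "same_letter_on A x y \<Longrightarrow> same_letter_on A y x"
  by (cases x; cases y) simp_all

lemma same_letter_on_trans:
  "same_letter_on A x y \<Longrightarrow> same_letter_on A y z \<Longrightarrow> same_letter_on A x z"
  by (cases x; cases y; cases z) simp_all

lemma snth_cycle: "P \<noteq> [] \<Longrightarrow> Stream.cycle P !! n = P ! (n mod length P)"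
proof -
  assume P: "P \<noteq> []"
  have "Stream.cycle P !! n = shd (sdrop n (Stream.cycle P))" by simp
  also have "\<dots> = P ! (n mod length P)"
    using P by (subst sdrop_cycle) (simp_all add: hd_rotate_conv_nth del: sdrop_simps)
  finally show ?thesis .
qed

lemma identified_toeplitz:
  assumes "(P, Q) \<in> identified"
  shows "toeplitz P (Suc n) = toeplitz Q (Suc n)"
proof (induction n rule: less_induct)
  case (less n)
  have P: "sym_headed_pattern P" and Q: "sym_headed_pattern Q"
    and all2: "list_all2 (same_letter_on (toeplitz_letters P)) P Q"
    using assms by (auto simp: identified_def)
  have ne: "P \<noteq> []" "Q \<noteq> []"
    using P Q by (auto simp: sym_headed_pattern_def)
  have same: "same_letter_on (toeplitz_letters P) (Stream.cycle P !! i) (Stream.cycle Q !! i)"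
    for i
    using all2 ne by (simp add: snth_cycle list_all2_conv_all_nth)
  have gap_iff: "is_gap (Stream.cycle P !! i) \<longleftrightarrow> is_gap (Stream.cycle Q !! i)" for i
    using same[of i] by (cases "Stream.cycle P !! i"; cases "Stream.cycle Q !! i") simp_all
  have gaps: "num_gaps (stake i (Stream.cycle P)) = num_gaps (stake i (Stream.cycle Q))" for i
  proof (induction i)
    case (Suc i)
    then show ?case
      using gap_iff[of i] by (simp add: num_gaps_def stake_Suc del: stake.simps(2))
  qed simp
  show ?case
  proof (cases "Stream.cycle P !! n")
    case (Sym a)
    with same[of n] have "Stream.cycle Q !! n = Sym a"
      by (cases "Stream.cycle Q !! n") simp_all
    with Sym show ?thesis
      by (simp add: toeplitz_rec[OF P, of n] toeplitz_rec[OF Q, of n])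
  next
    case (Gap f)
    with gap_iff[of n] obtain g where g: "Stream.cycle Q !! n = Gap g" by auto
    define m where "m = num_gaps (stake n (Stream.cycle P))"
    have "m < n"
      unfolding m_def using num_gaps_stake_cycle_less[OF P Gap] .
    then have IH: "toeplitz P (Suc m) = toeplitz Q (Suc m)" by (rule less)
    have "toeplitz P (Suc m) \<in> toeplitz_letters P"
      by (auto simp: toeplitz_letters_def)
    with same[of n] have "f \<langle>$\<rangle> (toeplitz P (Suc m)) = g \<langle>$\<rangle> (toeplitz P (Suc m))"
      by (simp add: Gap g)
    then show ?thesis
      using IH
      by (simp add: toeplitz_rec[OF P, of n] toeplitz_rec[OF Q, of n] Gap g
          gaps[symmetric] m_def[symmetric])
  qed
qed

lemma identified_toeplitz_letters:
  assumes "(P, Q) \<in> identified"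
  shows "toeplitz_letters P = toeplitz_letters Q"
proof -
  have "toeplitz P n = toeplitz Q n" if "n \<in> {1..}" for n
    using identified_toeplitz[OF assms, of "n - 1"] that by simp
  then show ?thesis
    unfolding toeplitz_letters_def by (rule image_cong[OF refl])
qed

lemma equiv_identified: "equiv {P :: 'a word. sym_headed_pattern P} identified"
proof (rule equivI)
  show "(identified :: ('a word \<times> 'a word) set) \<subseteq> {P. sym_headed_pattern P} \<times> {P. sym_headed_pattern P}"
    by (auto simp: identified_def)
  show "refl_on {P. sym_headed_pattern P} (identified :: ('a word \<times> 'a word) set)"
    by (auto simp: refl_on_def identified_def intro!: list_all2_refl same_letter_on_refl)
  show "sym (identified :: ('a word \<times> 'a word) set)"
  proof (rule symI)
    fix P Q :: "'a word"
    assume PQ: "(P, Q) \<in> identified"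
    then show "(Q, P) \<in> identified"
      using identified_toeplitz_letters[OF PQ]
      by (auto simp: identified_def list_all2_conv_all_nth intro: same_letter_on_sym)
  qed
  show "trans (identified :: ('a word \<times> 'a word) set)"
  proof (rule transI)
    fix P Q R :: "'a word"
    assume PQ: "(P, Q) \<in> identified" and QR: "(Q, R) \<in> identified"
    from PQ QR have "sym_headed_pattern P" and "sym_headed_pattern R"
      and 1: "list_all2 (same_letter_on (toeplitz_letters P)) P Q"
      and 2: "list_all2 (same_letter_on (toeplitz_letters P)) Q R"
      using identified_toeplitz_letters[OF PQ] by (simp_all add: identified_def)
    moreover have "list_all2 (same_letter_on (toeplitz_letters P)) P R"
      using same_letter_on_trans 1 2 by (rule list_all2_trans)
    ultimately show "(P, R) \<in> identified"
      by (simp add: identified_def)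
  qed
qed


subsection \<open>Composition of patterns\<close>

definition xi :: "nat \<Rightarrow> nat \<Rightarrow> nat" where
  "xi n m = m div gcd n m"

definition word_power :: "'a word \<Rightarrow> nat \<Rightarrow> 'a word" where
  "word_power P d = concat (replicate d P)"

definition pattern_comp :: "'a word \<Rightarrow> 'a word \<Rightarrow> 'a word" where
  "pattern_comp P Q = (if num_gaps P = 0 then P
     else fill (word_power P (xi (num_gaps P) (length Q)))
               (word_power Q (xi (length Q) (num_gaps P))))"

primrec pattern_power :: "'a word \<Rightarrow> nat \<Rightarrow> 'a word" where
  "pattern_power P 0 = [Gap 1]"
| "pattern_power P (Suc n) = pattern_comp P (pattern_power P n)"


subsection \<open>Discrete logarithms\<close>

definition dlog :: "nat \<Rightarrow> nat \<Rightarrow> nat \<Rightarrow> nat" where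
  "dlog p g a = (THE e. e \<le> p - 2 \<and> [g ^ e = a] (mod p))"

lemma dlog_unique_exists:
  assumes "prime p" and "residue_primroot p g" and "a \<in> {1..<p}"
  shows "\<exists>!e. e \<le> p - 2 \<and> [g ^ e = a] (mod p)"
proof -
  have p: "p \<ge> 2" using assms(1) by (rule prime_ge_2_nat)
  have bij: "bij_betw (\<lambda>i. g ^ i mod p) {..<p - 1} (totatives p)"
    using residue_primroot_is_generator[of p g] assms(1,2) p by (simp add: totient_prime)
  have "a \<in> totatives p"
    using assms(1,3) by (auto simp: totatives_prime)
  with bij obtain e where e: "e \<in> {..<p - 1}" "g ^ e mod p = a"
    unfolding bij_betw_def by force
  have "\<exists>!e. e \<in> {..<p - 1} \<and> g ^ e mod p = a"
  proof (rule ex1I)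
    fix e' assume "e' \<in> {..<p - 1} \<and> g ^ e' mod p = a"
    with e show "e' = e"
      using inj_onD[OF bij_betw_imp_inj_on[OF bij], of e' e] by simp
  qed (use e in simp)
  moreover have "e \<in> {..<p - 1} \<longleftrightarrow> e \<le> p - 2" for e
    using p by auto
  ultimately show ?thesis
    using assms(3) by (simp add: cong_def)
qed

definition lambda_word :: "nat \<Rightarrow> nat \<Rightarrow> nat list" where
  "lambda_word p g = map (dlog p g) [1..<p]"

definition nat_mult :: "nat \<Rightarrow> 'a::comm_monoid_add \<Rightarrow> 'a" where
  "nat_mult j c = (\<Sum>i<j. c)"

definition scale_word :: "nat list \<Rightarrow> 'a::comm_monoid_add \<Rightarrow> 'a word" where
  "scale_word w c = map (\<lambda>j. Sym (nat_mult j c)) w"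


subsection \<open>The two sets of patterns\<close>

definition additive_one_gap_patterns :: "'a::monoid_add word set" where
  "additive_one_gap_patterns =
     {P. sym_headed_pattern P \<and> num_gaps P = 1 \<and> completely_additive (toeplitz P)}"

definition log_patterns :: "(nat \<Rightarrow> nat) \<Rightarrow> 'k::finite mod_ring word set" where
  "log_patterns g =
     {pattern_power (scale_word (lambda_word p (g p)) c @ [Gap (rotation d)]) k | p k c d.
        prime p \<and> k \<ge> 1 \<and> (\<exists>c'. c = nat_mult (xi (p - 1) CARD('k mod_ring)) c')}"

definition zero_patterns :: "'a::zero word set" where
  "zero_patterns = {replicate j (Sym 0) @ [Gap 1] @ replicate l (Sym 0) | j l. j \<ge> 1}"

end

theory Submission
  imports Defs
begin

text \<open>
  Let \<open>\<sigma>\<close> be the Toeplitz word of a one-gap pattern of length \<open>r\<close>, and assume that \<open>\<sigma>\<close> is completely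
  additive. If the last letter of the pattern is a symbol, then \<open>\<sigma> (r n)\<close> does not depend on \<open>n\<close>, so
  \<open>\<sigma> = 0\<close>. Otherwise \<open>\<sigma>\<close> has period \<open>r\<close> off the multiples of \<open>r\<close>, and additivity passes this on to
  every divisor \<open>s\<close> of \<open>r\<close>: \<open>\<sigma>\<close> has period \<open>s\<close> off the multiples of \<open>s\<close>. If two different primes
  divide \<open>r\<close>, the Chinese remainder theorem then forces \<open>\<sigma> = 0\<close>. If \<open>r = p\<^sup>k\<close>, then \<open>\<sigma>\<close> induces a
  homomorphism on the units modulo \<open>p\<close>, hence is \<open>\<sigma> g\<close> times the discrete logarithm there, and
  together with \<open>\<sigma> p\<close> this determines \<open>\<sigma>\<close>.
\<close>

subsection \<open>Patterns with one gap\<close>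

lemma num_gaps_append: "num_gaps (P @ Q) = num_gaps P + num_gaps Q"
  by (simp add: num_gaps_def)

lemma num_gaps_map_Sym: "num_gaps (map (\<lambda>i. Sym (u i)) xs) = 0"
  by (induction xs) (simp_all add: num_gaps_def)

lemma num_gaps_0_imp_map_Sym:
  assumes "num_gaps P = 0"
  shows "\<exists>u. P = map Sym u"
  using assms
proof (induction P)
  case (Cons x P)
  then obtain a where "x = Sym a"
    by (cases x) (auto simp: num_gaps_def)
  moreover obtain u where "P = map Sym u"
    using Cons by (auto simp: num_gaps_def split: if_splits)
  ultimately have "x # P = map Sym (a # u)" by simp
  then show ?case by (rule exI)
qed simp

lemma one_gap_split:
  assumes "num_gaps P = 1"
  obtains u f v where "P = map Sym u @ Gap f # map Sym v"
proof -
  have "filter is_gap P \<noteq> []"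
    using assms by (auto simp: num_gaps_def)
  then obtain f where "Gap f \<in> set P"
    by (auto simp: filter_empty_conv)
  then obtain Q R where P: "P = Q @ Gap f # R"
    by (meson split_list)
  then have "num_gaps Q = 0" "num_gaps R = 0"
    using assms by (auto simp: num_gaps_def)
  then show ?thesis
    using that P num_gaps_0_imp_map_Sym by metis
qed

lemma num_gaps_concat_replicate: "num_gaps (concat (replicate n P)) = n * num_gaps P"
  by (induction n) (simp_all add: num_gaps_append, simp add: num_gaps_def)

lemma num_gaps_stake_cycle:
  assumes "P \<noteq> []"
  shows "num_gaps (stake n (Stream.cycle P)) =
    (n div length P) * num_gaps P + num_gaps (take (n mod length P) P)"
  using assms by (simp add: stake_cycle num_gaps_append num_gaps_concat_replicate)

lemma toeplitz_Sym:
  assumes "sym_headed_pattern P" and "P ! (n mod length P) = Sym a"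
  shows "toeplitz P (Suc n) = a"
proof -
  have "P \<noteq> []" using assms(1) by (simp add: sym_headed_pattern_def)
  then show ?thesis
    by (simp add: toeplitz_rec[OF assms(1), of n] snth_cycle assms(2))
qed

text \<open>Each full period before index \<open>n\<close> contributes one gap and the current
  period none yet, so the gap reads the letter with 0-based index
  \<open>n div length P\<close>.\<close>

lemma toeplitz_one_gap:
  assumes "sym_headed_pattern P" and "num_gaps P = 1" and gap: "P ! (n mod length P) = Gap f"
  shows "toeplitz P (Suc n) = f \<langle>$\<rangle> (toeplitz P (Suc (n div length P)))"
proof -
  have P: "P \<noteq> []" using assms(1) by (simp add: sym_headed_pattern_def)
  define j where "j = n mod length P"
  have "j < length P" using P by (simp add: j_def)
  then have "P = take j P @ P ! j # drop (Suc j) P"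
    by (rule id_take_nth_drop)
  then have "num_gaps P = num_gaps (take j P) + num_gaps (Gap f # drop (Suc j) P)"
    using gap by (metis j_def num_gaps_append)
  then have "num_gaps (take j P) = 0"
    using assms(2) by (simp add: num_gaps_def)
  then have "num_gaps (stake n (Stream.cycle P)) = n div length P"
    using P assms(2) by (simp add: num_gaps_stake_cycle j_def)
  then show ?thesis
    using P gap by (simp add: toeplitz_rec[OF assms(1), of n] snth_cycle)
qed


subsection \<open>Patterns whose only gap is the last letter\<close>

text \<open>The symbols come from a function on positive integers rather than a list, so that a
  Toeplitz word can itself serve as \<tau>. For \<open>r\<close> \<ge> 1 the length, gap included,
  is \<open>r\<close>.\<close>

definition end_gap_pattern :: "(nat \<Rightarrow> 'a) \<Rightarrow> nat \<Rightarrow> 'a Perm.perm \<Rightarrow> 'a word" where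
  "end_gap_pattern \<tau> r f = map (\<lambda>i. Sym (\<tau> i)) [1..<r] @ [Gap f]"

lemma length_end_gap_pattern: "r \<ge> 1 \<Longrightarrow> length (end_gap_pattern \<tau> r f) = r"
  by (simp add: end_gap_pattern_def)

lemma num_gaps_end_gap_pattern: "num_gaps (end_gap_pattern \<tau> r f) = 1"
  unfolding end_gap_pattern_def num_gaps_append num_gaps_map_Sym by (simp add: num_gaps_def)

lemma sym_headed_end_gap_pattern:
  assumes "r \<ge> 2"
  shows "sym_headed_pattern (end_gap_pattern \<tau> r f)"
proof -
  have "[1..<r] = 1 # [Suc 1..<r]" using assms by (intro upt_conv_Cons) simp
  then show ?thesis by (simp add: sym_headed_pattern_def end_gap_pattern_def)
qed

lemma nth_end_gap_pattern:
  assumes "i < r"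
  shows "end_gap_pattern \<tau> r f ! i = (if Suc i = r then Gap f else Sym (\<tau> (Suc i)))"
  using assms by (auto simp: end_gap_pattern_def nth_append)

lemma mult_add_div_mod:
  fixes j r m :: nat
  assumes "j < r"
  shows "(m * r + j) div r = m" "(m * r + j) mod r = j"
  using assms by simp_all

lemma toeplitz_end_gap_mult:
  assumes "r \<ge> 2" and "n \<ge> 1"
  shows "toeplitz (end_gap_pattern \<tau> r f) (r * n) = f \<langle>$\<rangle> (toeplitz (end_gap_pattern \<tau> r f) n)"
proof -
  let ?P = "end_gap_pattern \<tau> r f"
  obtain m where m: "n = Suc m" using assms(2) by (cases n) auto
  \<comment> \<open>The 1-based position \<open>r * n\<close> is the 0-based index \<open>i\<close>,
    the last place of block \<open>m\<close>.\<close>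
  define i where "i = m * r + (r - 1)"
  have i: "Suc i = r * n" using assms(1) by (simp add: i_def m)
  have mod: "i mod r = r - 1" and div: "i div r = m"
    using mult_add_div_mod[of "r - 1" r m] assms(1) by (simp_all only: i_def)
  have "?P ! (i mod length ?P) = Gap f"
    using assms(1) mod by (simp add: length_end_gap_pattern nth_end_gap_pattern)
  from toeplitz_one_gap[OF sym_headed_end_gap_pattern[OF assms(1)] num_gaps_end_gap_pattern this]
  show ?thesis
    using assms(1) i div m by (simp add: length_end_gap_pattern)
qed

lemma toeplitz_end_gap_nonmult:
  assumes "r \<ge> 2" and "\<not> r dvd n"
  shows "toeplitz (end_gap_pattern \<tau> r f) n = \<tau> (n mod r)"
proof -
  let ?P = "end_gap_pattern \<tau> r f"
  obtain i where i: "n = Suc i" using assms(2) by (cases n) auto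
  have *: "Suc (i mod r) \<noteq> r"
    using assms(2) by (metis i mod_0_imp_dvd mod_Suc)
  have "?P ! (i mod length ?P) = Sym (\<tau> (Suc (i mod r)))"
    using assms(1) * by (simp add: length_end_gap_pattern nth_end_gap_pattern)
  from toeplitz_Sym[OF sym_headed_end_gap_pattern[OF assms(1)] this]
  show ?thesis
    using i * by (simp add: mod_Suc)
qed

text \<open>A value at a multiple of \<open>r\<close> reduces to a smaller argument and every other
  value is prescribed, so the two rules have a single solution. This is the tool for recognising
  Toeplitz words.\<close>

lemma toeplitz_end_gap_unique:
  assumes "r \<ge> 2"
    and "\<And>n. n \<ge> 1 \<Longrightarrow> \<sigma> (r * n) = f \<langle>$\<rangle> (\<sigma> n)"
    and "\<And>n. \<not> r dvd n \<Longrightarrow> \<sigma> n = \<tau> (n mod r)"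
    and "n \<ge> 1"
  shows "toeplitz (end_gap_pattern \<tau> r f) n = \<sigma> n"
  using assms(4)
proof (induction n rule: less_induct)
  case (less n)
  show ?case
  proof (cases "r dvd n")
    case True
    then obtain m where m: "n = r * m" by auto
    then have "m \<ge> 1" "m < n" using less.prems assms(1) by auto
    then show ?thesis
      using less.IH[of m] assms(2)[of m] toeplitz_end_gap_mult[OF assms(1), of m \<tau> f] m by simp
  qed (simp add: assms toeplitz_end_gap_nonmult)
qed

lemma end_gap_pattern_cong:
  "(\<And>i. 1 \<le> i \<Longrightarrow> i < r \<Longrightarrow> \<tau> i = \<tau>' i) \<Longrightarrow> end_gap_pattern \<tau> r f = end_gap_pattern \<tau>' r f"
  by (auto simp: end_gap_pattern_def)

text \<open>Positions below \<open>r\<close> never meet the gap, so the word restores the symbols of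
  its own pattern. This gives a normal form.\<close>

lemma end_gap_pattern_toeplitz:
  assumes "r \<ge> 2"
  shows "end_gap_pattern (toeplitz (end_gap_pattern \<tau> r f)) r f = end_gap_pattern \<tau> r f"
proof (rule end_gap_pattern_cong)
  fix i assume "1 \<le> i" "i < r"
  then have "\<not> r dvd i" by (auto dest: dvd_imp_le)
  then show "toeplitz (end_gap_pattern \<tau> r f) i = \<tau> i"
    using toeplitz_end_gap_nonmult[OF assms, of i] \<open>i < r\<close> by simp
qed


subsection \<open>Powers\<close>

lemma fill_map_Sym: "fill (map (\<lambda>i. Sym (\<tau> i)) xs @ x) y = map (\<lambda>i. Sym (\<tau> i)) xs @ fill x y"
  by (induction xs) simp_all

lemma fill_end_gap_power:
  "fill (concat (replicate (length Q) (end_gap_pattern \<tau> r f))) Q =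
     concat (map (\<lambda>q. map (\<lambda>i. Sym (\<tau> i)) [1..<r] @ [subst_gap f q]) Q)"
proof (induction Q)
  case (Cons q Q)
  then show ?case by (simp add: end_gap_pattern_def fill_map_Sym)
qed simp

text \<open>Cut into blocks of length \<open>r\<close>, the word repeats the symbols of the pattern,
  and block \<open>i\<close> closes with the gap filled by letter \<open>i\<close>.\<close>

lemma toeplitz_block:
  assumes "r \<ge> 2" and "i \<ge> 1"
  shows "map (\<lambda>i. Sym (\<tau> i)) [1..<r] @ [Sym (f \<langle>$\<rangle> (toeplitz (end_gap_pattern \<tau> r f) i))] =
    map (\<lambda>n. Sym (toeplitz (end_gap_pattern \<tau> r f) n)) [r * (i - 1) + 1..<r * i + 1]"
    (is "?L = ?R")
proof (rule nth_equalityI)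
  have ri: "r * i = r * (i - 1) + r"
    using assms(2) by (cases i) auto
  show len: "length ?L = length ?R"
    using assms(1) ri by simp
  fix j assume "j < length ?L"
  then have j: "j < r" using assms(1) by simp
  have R: "?R ! j = Sym (toeplitz (end_gap_pattern \<tau> r f) (r * (i - 1) + 1 + j))"
    using j ri by (subst nth_map) (simp_all del: upt_Suc)
  show "?L ! j = ?R ! j"
  proof (cases "Suc j = r")
    case True
    then have "r * (i - 1) + 1 + j = r * i" using ri by simp
    then show ?thesis
      using True R toeplitz_end_gap_mult[OF assms, of \<tau> f] by (auto simp: nth_append)
  next
    case False
    have mod: "(r * (i - 1) + 1 + j) mod r = Suc j"
      using mult_add_div_mod(2)[of "Suc j" r "i - 1"] j False by (simp add: mult.commute)
    then have "\<not> r dvd r * (i - 1) + 1 + j" by (simp add: dvd_eq_mod_eq_0)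
    from toeplitz_end_gap_nonmult[OF assms(1) this, of \<tau> f] show ?thesis
      using R mod False j less_diff_conv[of j r 1] by (simp add: nth_append)
  qed
qed

lemma concat_blocks:
  assumes "N \<ge> 1"
  shows "concat (map (\<lambda>i. map h [r * (i - 1) + 1..<r * i + 1]) [1..<N]) = map h [1..<r * (N - 1) + 1]"
  using assms
proof (induction N rule: nat_induct_at_least)
  case (Suc N)
  have "r * (N - 1) \<le> r * N" by simp
  then have "[1..<r * N + 1] = [1..<r * (N - 1) + 1] @ [r * (N - 1) + 1..<r * N + 1]"
    using upt_add_eq_append[of 1 "r * (N - 1) + 1" "r * N - r * (N - 1)"] by simp
  then show ?case using Suc by simp
qed simp

text \<open>With a single gap the two exponents are \<open>length Q\<close> and \<open>1\<close>, so
  each letter of \<open>Q\<close> fills its own copy of the pattern.\<close>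

lemma pattern_comp_end_gap:
  "pattern_comp (end_gap_pattern \<tau> r f) Q =
     concat (map (\<lambda>q. map (\<lambda>i. Sym (\<tau> i)) [1..<r] @ [subst_gap f q]) Q)"
  by (simp add: pattern_comp_def num_gaps_end_gap_pattern xi_def word_power_def fill_end_gap_power)

text \<open>Filling the pattern with a prefix of its own Toeplitz word yields a prefix
  \<open>r\<close> times as long, while the closing gap picks up one more factor
  \<open>f\<close>.\<close>

lemma pattern_power_end_gap:
  assumes "r \<ge> 2"
  shows "pattern_power (end_gap_pattern \<tau> r f) k =
    end_gap_pattern (toeplitz (end_gap_pattern \<tau> r f)) (r ^ k) (f ^ k)"
proof (induction k)
  case 0
  show ?case by (simp add: end_gap_pattern_def)
next
  case (Suc k)
  define T where "T = toeplitz (end_gap_pattern \<tau> r f)"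
  define N where "N = r ^ k"
  have N: "N \<ge> 1" using assms by (simp add: N_def)
  define w where "w = map (\<lambda>i. Sym (\<tau> i)) [1..<r]"
  have w: "w = map (\<lambda>i. Sym (T i)) [1..<r]"
    using end_gap_pattern_toeplitz[OF assms, of \<tau> f] by (simp add: end_gap_pattern_def T_def w_def)
  have "pattern_power (end_gap_pattern \<tau> r f) (Suc k) =
    concat (map (\<lambda>q. w @ [subst_gap f q]) (end_gap_pattern T N (f ^ k)))"
    by (simp add: Suc pattern_comp_end_gap T_def N_def w_def)
  \<comment> \<open>The first \<open>N - 1\<close> letters of the inner power are symbols and
    complete their blocks; its gap leaves the last block open.\<close>
  also have "\<dots> = concat (map (\<lambda>i. w @ [Sym (f \<langle>$\<rangle> (T i))]) [1..<N]) @ w @ [Gap (f ^ Suc k)]"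
    by (simp add: end_gap_pattern_def comp_def)
  also have "map (\<lambda>i. w @ [Sym (f \<langle>$\<rangle> (T i))]) [1..<N] =
      map (\<lambda>i. map (\<lambda>n. Sym (T n)) [r * (i - 1) + 1..<r * i + 1]) [1..<N]"
    unfolding w_def T_def by (intro map_cong refl toeplitz_block assms) simp
  also have "concat \<dots> = map (\<lambda>n. Sym (T n)) [1..<r * (N - 1) + 1]"
    by (rule concat_blocks[OF N])
  \<comment> \<open>The open block stops short of the multiple \<open>r * N\<close>, so it contains
    no multiple of \<open>r\<close> and the word shows the pattern symbols there.\<close>
  also have "w = map (\<lambda>n. Sym (T n)) [r * (N - 1) + 1..<r * N]"
  proof (rule nth_equalityI)
    have rN: "r * N = r * (N - 1) + r" using N by (cases N) auto
    show "length w = length (map (\<lambda>n. Sym (T n)) [r * (N - 1) + 1..<r * N])"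
      using rN by (simp add: w)
    fix j assume "j < length w"
    then have j: "Suc j < r" by (simp add: w)
    have mod: "(r * (N - 1) + 1 + j) mod r = Suc j"
      using j by simp
    then have "\<not> r dvd r * (N - 1) + 1 + j" by (simp add: dvd_eq_mod_eq_0)
    from toeplitz_end_gap_nonmult[OF assms this, of \<tau> f] mod
    show "w ! j = map (\<lambda>n. Sym (T n)) [r * (N - 1) + 1..<r * N] ! j"
      using j rN by (simp add: w_def T_def)
  qed
  also have "map (\<lambda>n. Sym (T n)) [1..<r * (N - 1) + 1] @
      map (\<lambda>n. Sym (T n)) [r * (N - 1) + 1..<r * N] @ [Gap (f ^ Suc k)] =
      end_gap_pattern T (r * N) (f ^ Suc k)"
  proof -
    have "r * (N - 1) + 1 \<le> r * N" using N assms by (cases N) auto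
    then have "[1..<r * N] = [1..<r * (N - 1) + 1] @ [r * (N - 1) + 1..<r * N]"
      using upt_add_eq_append[of 1 "r * (N - 1) + 1" "r * N - (r * (N - 1) + 1)"]
      by (simp only: le_add_diff_inverse le_add2)
    then show ?thesis by (simp only: end_gap_pattern_def map_append append_assoc)
  qed
  finally show ?case by (simp add: T_def N_def)
qed

section \<open>Toeplitz words of powers\<close>

lemma toeplitz_end_gap_mult_power:
  assumes "r \<ge> 2" and "n \<ge> 1"
  shows "toeplitz (end_gap_pattern \<tau> r f) (r ^ k * n) =
    (f ^ k) \<langle>$\<rangle> (toeplitz (end_gap_pattern \<tau> r f) n)"
proof (induction k)
  case (Suc k)
  have "r ^ k * n \<ge> 1" using assms by simp
  from toeplitz_end_gap_mult[OF assms(1) this, of \<tau> f] Suc show ?case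
    by (simp add: mult.assoc apply_times)
qed simp

text \<open>If \<open>r\<close> divides \<open>n\<close>, a factor \<open>r\<close> comes out of
  both \<open>n\<close> and its residue, which lowers the exponent by one; otherwise only
  \<open>n mod r\<close> matters.\<close>

lemma toeplitz_end_gap_mod_power:
  assumes "r \<ge> 2" and "\<not> r ^ k dvd n"
  shows "toeplitz (end_gap_pattern \<tau> r f) (n mod r ^ k) = toeplitz (end_gap_pattern \<tau> r f) n"
  using assms(2)
proof (induction k arbitrary: n)
  case (Suc k)
  show ?case
  proof (cases "r dvd n")
    case True
    then obtain m where m: "n = r * m" by auto
    then have ndvd: "\<not> r ^ k dvd m" using Suc.prems assms(1) by simp
    then have "m mod r ^ k \<ge> 1" "m \<ge> 1"
      by (auto simp: dvd_eq_mod_eq_0 Suc_le_eq intro: Nat.gr0I)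
    then show ?thesis
      using Suc.IH[OF ndvd] by (simp add: m mult_mod_right[symmetric] toeplitz_end_gap_mult assms(1))
  next
    case False
    have "n mod (r * r ^ k) mod r = n mod r" by (simp add: mod_mod_cancel)
    moreover from this have "\<not> r dvd n mod r ^ Suc k"
      using False by (simp add: dvd_eq_mod_eq_0)
    ultimately show ?thesis
      using False by (simp add: toeplitz_end_gap_nonmult assms(1))
  qed
qed simp

text \<open>The word of the base pattern obeys the recursion of the power, with \<open>r ^ k\<close>
  and \<open>f ^ k\<close> for \<open>r\<close> and \<open>f\<close>. For \<open>k = 0\<close> the
  power would be a lone gap.\<close>

lemma toeplitz_pattern_power:
  assumes "r \<ge> 2" and "k \<ge> 1" and "n \<ge> 1"
  shows "toeplitz (pattern_power (end_gap_pattern \<tau> r f) k) n = toeplitz (end_gap_pattern \<tau> r f) n"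
proof -
  have "r ^ 1 \<le> r ^ k" using assms(1,2) by (intro power_increasing) auto
  then have rk: "r ^ k \<ge> 2" using assms(1) by simp
  show ?thesis
    unfolding pattern_power_end_gap[OF assms(1)]
    by (rule toeplitz_end_gap_unique[OF rk _ _ assms(3)])
      (simp_all add: toeplitz_end_gap_mult_power toeplitz_end_gap_mod_power assms(1))
qed


subsection \<open>Multiples in the alphabet\<close>

lemma nat_mult_0: "nat_mult 0 c = 0"
  by (simp add: nat_mult_def)

lemma nat_mult_add: "nat_mult (i + j) c = nat_mult i c + nat_mult j c"
  by (induction j) (simp_all add: nat_mult_def ac_simps)

lemma nat_mult_mult: "nat_mult (i * j) c = nat_mult i (nat_mult j c)"
  by (induction i) (simp_all add: nat_mult_0 nat_mult_add add.commute, simp add: nat_mult_def add.commute)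

lemma nat_mult_cong:
  assumes "nat_mult m c = 0" and "[i = j] (mod m)"
  shows "nat_mult i c = nat_mult j c"
proof -
  have zero: "nat_mult q (0 :: 'a) = 0" for q by (simp add: nat_mult_def)
  have "nat_mult i c = nat_mult (i mod m) c" for i
  proof -
    have "nat_mult i c = nat_mult (i div m * m + i mod m) c" by simp
    also have "\<dots> = nat_mult (i mod m) c"
      by (simp only: nat_mult_add nat_mult_mult assms(1) zero) simp
    finally show ?thesis .
  qed
  then show ?thesis using assms(2) by (metis cong_def)
qed

lemma to_int_nat_mult:
  fixes c :: "'k::finite mod_ring"
  shows "to_int_mod_ring (nat_mult j c) = int j * to_int_mod_ring c mod int CARD('k)"
proof (induction j)
  case (Suc j)
  have add: "to_int_mod_ring (a + b) = (to_int_mod_ring a + to_int_mod_ring b) mod int CARD('k)"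
    for a b :: "'k mod_ring" by transfer simp
  have "nat_mult (Suc j) c = nat_mult j c + c" by (simp add: nat_mult_def add.commute)
  then show ?case by (simp add: add Suc mod_simps algebra_simps)
qed (simp add: nat_mult_0)

text \<open>Cancelling the gcd of \<open>m\<close> and the group order leaves coprime cofactors, so
  the reduced order must divide the representative of \<open>c\<close>. This turns the divisibility
  condition in \<open>log_patterns\<close> into the usable form that \<open>p - 1\<close>
  annihilates \<open>c\<close>.\<close>

lemma nat_mult_eq_0_iff:
  fixes c :: "'k::finite mod_ring"
  shows "nat_mult m c = 0 \<longleftrightarrow> (\<exists>c'. c = nat_mult (xi m CARD('k mod_ring)) c')"
proof -
  let ?K = "CARD('k)" and ?x = "to_int_mod_ring c"
  define q where "q = gcd m ?K"
  define K' where "K' = ?K div q"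
  define m' where "m' = m div q"
  have q: "q > 0" unfolding q_def by simp
  have K: "?K = q * K'" and m: "m = q * m'"
    by (simp_all add: q_def K'_def m'_def)
  have xi: "xi m CARD('k mod_ring) = K'" by (simp add: xi_def q_def K'_def)
  show ?thesis
    unfolding xi
  proof
    assume "nat_mult m c = 0"
    then have "int ?K dvd int m * ?x"
      using to_int_nat_mult[of m c] by (simp add: dvd_eq_mod_eq_0)
    then have "int K' dvd int m' * ?x"
      unfolding K m using q by (simp add: mult.assoc)
    moreover have "coprime m' K'"
      unfolding m'_def K'_def q_def by (rule div_gcd_coprime) simp
    then have "coprime (int K') (int m')"
      by (simp add: coprime_commute)
    ultimately have "int K' dvd ?x" by (simp add: coprime_dvd_mult_right_iff)
    then obtain y where y: "?x = int K' * y" by (auto elim: dvdE)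
    \<comment> \<open>\<open>?x\<close> is the reduced representative, so reducing
      \<open>int K' * y\<close> returns it and the class of \<open>y\<close> is the witness.\<close>
    have "?x \<in> {0..<int ?K}" using range_to_int_mod_ring[where ?'a = 'k] by blast
    then have "(int K' * y) mod int ?K = ?x" by (simp add: y)
    moreover have "to_int_mod_ring (of_int_mod_ring y :: 'k mod_ring) = y mod int ?K"
      by transfer simp
    ultimately have "to_int_mod_ring (nat_mult K' (of_int_mod_ring y :: 'k mod_ring)) = ?x"
      by (simp add: to_int_nat_mult mod_mult_right_eq)
    then have "c = nat_mult K' (of_int_mod_ring y)"
      by (metis of_int_mod_ring_to_int_mod_ring)
    then show "\<exists>c'. c = nat_mult K' c'" by blast
  next
    assume "\<exists>c'. c = nat_mult K' c'"
    then obtain c' where "c = nat_mult K' c'" by blast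
    then have "nat_mult m c = nat_mult (m * K') c'" by (simp add: nat_mult_mult)
    also have "m * K' = m' * ?K" unfolding K by (subst m) simp
    also have "to_int_mod_ring (nat_mult (m' * ?K) c') = 0"
      by (simp add: to_int_nat_mult)
    then have "nat_mult (m' * ?K) c' = 0" by simp
    finally show "nat_mult m c = 0" .
  qed
qed


subsection \<open>Completely additive functions\<close>

lemma completely_additive_1: "completely_additive \<sigma> \<Longrightarrow> \<sigma> (Suc 0) = 0"
  by (simp add: completely_additive_def)

lemma completely_additive_mult:
  "completely_additive \<sigma> \<Longrightarrow> n \<ge> 1 \<Longrightarrow> m \<ge> 1 \<Longrightarrow> \<sigma> (n * m) = \<sigma> n + \<sigma> m"
  by (simp add: completely_additive_def)

lemma completely_additive_power:
  fixes \<sigma> :: "nat \<Rightarrow> 'a::comm_monoid_add"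
  assumes "completely_additive \<sigma>" and "n \<ge> 1"
  shows "\<sigma> (n ^ k) = nat_mult k (\<sigma> n)"
proof (induction k)
  case (Suc k)
  have "\<sigma> (n * n ^ k) = \<sigma> n + \<sigma> (n ^ k)"
    using assms by (intro completely_additive_mult) auto
  then show ?case by (simp add: Suc nat_mult_def add.commute)
qed (simp add: completely_additive_1[OF assms(1)] nat_mult_0)

text \<open>Agreement at positive arguments is all that can be asked, since a Toeplitz word has a
  junk value at 0.\<close>

lemma completely_additive_cong:
  assumes "completely_additive \<sigma>" and "\<And>n. n \<ge> 1 \<Longrightarrow> \<tau> n = \<sigma> n"
  shows "completely_additive \<tau>"
  unfolding completely_additive_def
proof (intro conjI allI impI)
  show "\<tau> 1 = 0" using assms by (simp add: completely_additive_1)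
  fix n m :: nat assume "n \<ge> 1" "m \<ge> 1"
  then have "n * m \<ge> 1" by simp
  with \<open>n \<ge> 1\<close> \<open>m \<ge> 1\<close> show "\<tau> (n * m) = \<tau> n + \<tau> m"
    using assms completely_additive_mult by metis
qed

text \<open>
  Multiplying by \<open>r / s\<close> turns \<open>s\<close> into \<open>r\<close>, and additivity cancels that factor: the period \<open>r\<close>
  descends to every divisor \<open>s\<close>.
\<close>

lemma period_descends:
  fixes \<sigma> :: "nat \<Rightarrow> 'a::cancel_comm_monoid_add"
  assumes add: "completely_additive \<sigma>"
    and per: "\<And>n. \<not> r dvd n \<Longrightarrow> \<sigma> (n mod r) = \<sigma> n"
    and "r \<ge> 1" "s dvd r" "\<not> s dvd n" "[n = m] (mod s)"
  shows "\<sigma> n = \<sigma> m"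
proof -
  obtain d where d: "r = d * s" using \<open>s dvd r\<close> by (metis dvd_def mult.commute)
  have d1: "d \<ge> 1" using \<open>r \<ge> 1\<close> d by (cases d) auto
  have red: "\<sigma> n = \<sigma> (n mod s)" if "\<not> s dvd n" for n
  proof -
    have n: "n \<ge> 1" "n mod s \<ge> 1"
      using that by (auto simp: dvd_eq_mod_eq_0 Suc_le_eq intro: Nat.gr0I)
    have "\<not> r dvd d * n" using that d d1 by simp
    from per[OF this] have "\<sigma> (d * (n mod s)) = \<sigma> (d * n)"
      by (simp only: d mult_mod_right)
    then have "\<sigma> d + \<sigma> (n mod s) = \<sigma> d + \<sigma> n"
      using completely_additive_mult[OF add d1 n(1)] completely_additive_mult[OF add d1 n(2)] by simp
    then show ?thesis by simp
  qed
  have "\<not> s dvd m" using \<open>\<not> s dvd n\<close> \<open>[n = m] (mod s)\<close> cong_dvd_iff by blast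
  with red[OF \<open>\<not> s dvd n\<close>] red[of m] \<open>[n = m] (mod s)\<close> show ?thesis by (simp add: cong_def)
qed

text \<open>A number prime to \<open>p\<close> can be moved within its class modulo \<open>p\<close>
  until it is 1 modulo \<open>q\<close>, where the value is that at 1. Then \<sigma> is shown to
  vanish at \<open>p\<close>, and all other numbers lose their factors \<open>p\<close> one at a
  time.\<close>

lemma two_prime_periods_imp_zero:
  fixes \<sigma> :: "nat \<Rightarrow> 'a::cancel_comm_monoid_add"
  assumes add: "completely_additive \<sigma>"
    and "prime p" "prime q" "p \<noteq> q"
    and p_per: "\<And>n m. \<not> p dvd n \<Longrightarrow> [n = m] (mod p) \<Longrightarrow> \<sigma> n = \<sigma> m"
    and q_per: "\<And>n m. \<not> q dvd n \<Longrightarrow> [n = m] (mod q) \<Longrightarrow> \<sigma> n = \<sigma> m"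
    and "n \<ge> 1"
  shows "\<sigma> n = 0"
proof -
  have cop: "coprime p q" using assms(2-4) by (simp add: primes_coprime)
  have q1: "\<not> q dvd 1" and pq: "\<not> q dvd p"
    using assms(2-4) primes_dvd_imp_eq[of q p] by (auto simp: not_prime_1)
  have coprime_p: "\<sigma> n = 0" if "\<not> p dvd n" for n
  proof -
    obtain x where x: "[x = n] (mod p)" "[x = 1] (mod q)"
      using binary_chinese_remainder_nat[OF cop] by blast
    have "\<sigma> n = \<sigma> x" using p_per[OF that cong_sym[OF x(1)]] .
    also have "\<dots> = \<sigma> 1" using q_per[OF q1 cong_sym[OF x(2)]] by simp
    finally show ?thesis using completely_additive_1[OF add] by simp
  qed
  have "\<sigma> p = 0"
  proof -
    \<comment> \<open>Here \<open>p\<close> is moved modulo \<open>q\<close> to a number prime to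
      \<open>p\<close>, where \<sigma> is already known to vanish.\<close>
    obtain x where x: "[x = p] (mod q)" "[x = 1] (mod p)"
      using binary_chinese_remainder_nat[of q p] cop by (auto simp: coprime_commute)
    have "\<not> p dvd x" using x(2) \<open>prime p\<close> cong_dvd_iff not_prime_unit by blast
    then show ?thesis using coprime_p q_per[OF pq cong_sym[OF x(1)]] by simp
  qed
  from \<open>n \<ge> 1\<close> show ?thesis
  proof (induction n rule: less_induct)
    case (less n)
    show ?case
    proof (cases "p dvd n")
      case True
      then obtain m where m: "n = p * m" by auto
      then have "m \<ge> 1" "m < n" "p \<ge> 1"
        using less.prems prime_gt_1_nat[OF \<open>prime p\<close>] by auto
      then show ?thesis
        using less.IH[of m] \<open>\<sigma> p = 0\<close> completely_additive_mult[OF add, of p m] m by simp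
    qed (rule coprime_p)
  qed
qed

text \<open>Once the full power of \<open>p\<close> is split off, the cofactor is 1 or has a prime
  divisor, which then differs from \<open>p\<close>.\<close>

lemma prime_power_or_two_primes:
  fixes r :: nat
  assumes "r \<ge> 2"
  obtains (power) p k where "prime p" "k \<ge> 1" "r = p ^ k"
  | (two) p q where "prime p" "prime q" "p \<noteq> q" "p dvd r" "q dvd r"
proof -
  obtain p where p: "prime p" "p dvd r"
    using prime_factor_nat[of r] assms by auto
  obtain m where m: "r = p ^ multiplicity p r * m" "\<not> p dvd m"
    using multiplicity_decompose'[of r p] assms p(1) by (metis not_prime_unit not_numeral_le_zero)
  show ?thesis
  proof (cases "m = 1")
    case True
    have "multiplicity p r \<ge> 1"
      using m True assms by (cases "multiplicity p r") auto
    then show ?thesis using power[OF p(1)] m True by simp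
  next
    case False
    then obtain q where q: "prime q" "q dvd m" using prime_factor_nat by blast
    then have "q dvd r" using m(1) by (metis dvd_mult)
    then show ?thesis using two[OF p(1) q(1) _ p(2)] q(2) m(2) by blast
  qed
qed


subsection \<open>Discrete logarithms\<close>

text \<open>The argument is reduced because \<open>dlog\<close> is only known to be determined
  between 1 and \<open>p - 1\<close>.\<close>

lemma power_dlog:
  assumes "prime p" "residue_primroot p g" "\<not> p dvd a"
  shows "[g ^ dlog p g (a mod p) = a] (mod p)"
proof -
  have "a mod p \<in> {1..<p}"
    using assms(1,3) by (auto simp: dvd_eq_mod_eq_0 Suc_le_eq prime_gt_0_nat intro: Nat.gr0I)
  from theI'[OF dlog_unique_exists[OF assms(1,2) this]]
  have "[g ^ dlog p g (a mod p) = a mod p] (mod p)" unfolding dlog_def by blast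
  then show ?thesis by (simp add: cong_def)
qed

text \<open>Exponents count modulo the order of \<open>g\<close>, which is the totient of
  \<open>p\<close>.\<close>

lemma primroot_power_cong_iff:
  assumes "prime p" "residue_primroot p g"
  shows "[g ^ i = g ^ j] (mod p) \<longleftrightarrow> [i = j] (mod (p - 1))"
  using assms order_divides_expdiff[of p g i j]
  by (simp add: residue_primroot_def totient_prime)

text \<open>Discrete logarithms add only modulo \<open>p - 1\<close>; since \<open>p - 1\<close>
  annihilates \<open>c\<close>, the wrap-around disappears after scaling.\<close>

lemma nat_mult_dlog_mult:
  assumes "prime p" "residue_primroot p g" "nat_mult (p - 1) c = 0" "\<not> p dvd a" "\<not> p dvd b"
  shows "nat_mult (dlog p g (a * b mod p)) c =
    nat_mult (dlog p g (a mod p)) c + nat_mult (dlog p g (b mod p)) c"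
proof -
  have "\<not> p dvd a * b" using assms(1,4,5) prime_dvd_mult_iff by blast
  then have "[g ^ dlog p g (a * b mod p) = a * b] (mod p)"
    by (rule power_dlog[OF assms(1,2)])
  also have "[a * b = g ^ (dlog p g (a mod p) + dlog p g (b mod p))] (mod p)"
    unfolding power_add by (intro cong_mult cong_sym[OF power_dlog] assms)
  finally have "[dlog p g (a * b mod p) = dlog p g (a mod p) + dlog p g (b mod p)] (mod (p - 1))"
    using primroot_power_cong_iff[OF assms(1,2)] by simp
  then show ?thesis
    using nat_mult_cong[OF assms(3)] nat_mult_add by metis
qed

lemma log_pattern_eq_end_gap:
  "scale_word (lambda_word p g) c @ [Gap f] = end_gap_pattern (\<lambda>i. nat_mult (dlog p g i) c) p f"
  by (simp add: scale_word_def lambda_word_def end_gap_pattern_def comp_def)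

text \<open>A factor \<open>p\<close> removed from either argument takes \<open>d\<close> off both
  sides, so induction on the product leaves two arguments prime to \<open>p\<close>, where the
  logarithm law applies.\<close>

lemma completely_additive_log_pattern:
  fixes c d :: "'a::{finite, ab_group_add}"
  assumes "prime p" "residue_primroot p g" "nat_mult (p - 1) c = 0"
  shows "completely_additive
    (toeplitz (end_gap_pattern (\<lambda>i. nat_mult (dlog p g i) c) p (rotation d)))"
    (is "completely_additive ?T")
proof -
  have p: "p \<ge> 2" using assms(1) by (rule prime_ge_2_nat)
  have mult: "?T (p * n) = ?T n + d" if "n \<ge> 1" for n
    by (subst toeplitz_end_gap_mult[OF p that]) (simp add: apply_rotation)
  have nonmult: "?T n = nat_mult (dlog p g (n mod p)) c" if "\<not> p dvd n" for n
    using toeplitz_end_gap_nonmult[OF p that] .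
  have ndvd1: "\<not> p dvd 1" using p by simp
  have "[g ^ dlog p g (1 mod p) = g ^ 0] (mod p)"
    using power_dlog[OF assms(1,2) ndvd1] by simp
  \<comment> \<open>The logarithm of 1 is congruent to 0 modulo \<open>p - 1\<close>, which suffices
    for multiples of \<open>c\<close>.\<close>
  then have "?T 1 = nat_mult 0 c"
    unfolding nonmult[OF ndvd1] primroot_power_cong_iff[OF assms(1,2)]
    by (rule nat_mult_cong[OF assms(3)])
  then have T1: "?T 1 = 0" by (simp add: nat_mult_0)
  have "?T (n * m) = ?T n + ?T m" if "n \<ge> 1" "m \<ge> 1" for n m
    using that
  proof (induction "n * m" arbitrary: n m rule: less_induct)
    case less
    consider "p dvd n" | "p dvd m" | "\<not> p dvd n" "\<not> p dvd m" by blast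
    then show ?case
    proof cases
      case 1
      then obtain n' where n: "n = p * n'" by auto
      have n': "n' \<ge> 1" using less.prems n by (cases n') auto
      then have "n' * m < n * m" "n' * m \<ge> 1" using less.prems p n by auto
      then show ?thesis
        using less.hyps[of n' m] n' less.prems mult[of n'] mult[of "n' * m"] n
        by (simp add: mult.assoc add_ac)
    next
      case 2
      then obtain m' where m: "m = p * m'" by auto
      have m': "m' \<ge> 1" using less.prems m by (cases m') auto
      then have "n * m' < n * m" "n * m' \<ge> 1" using less.prems p m by auto
      then show ?thesis
        using less.hyps[of n m'] m' less.prems mult[of m'] mult[of "n * m'"] m
        by (simp add: mult.left_commute add_ac)
    next
      case 3
      then have "\<not> p dvd n * m" using assms(1) prime_dvd_mult_iff by blast
      then show ?thesis
        using 3 nat_mult_dlog_mult[OF assms] by (simp add: nonmult)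
    qed
  qed
  then show ?thesis using T1 by (simp add: completely_additive_def)
qed

text \<open>With \<open>g\<close> generating the units, \<open>\<sigma>\<close> is determined by \<open>c = \<sigma> g\<close> and \<open>\<sigma> p\<close>.\<close>

lemma prime_period_imp_log_pattern:
  fixes \<sigma> :: "nat \<Rightarrow> 'a::{finite, ab_group_add}"
  assumes add: "completely_additive \<sigma>" and "prime p" and g: "residue_primroot p g"
    and per: "\<And>n m. \<not> p dvd n \<Longrightarrow> [n = m] (mod p) \<Longrightarrow> \<sigma> n = \<sigma> m"
  shows "nat_mult (p - 1) (\<sigma> g) = 0"
    and "n \<ge> 1 \<Longrightarrow>
      toeplitz (end_gap_pattern (\<lambda>i. nat_mult (dlog p g i) (\<sigma> g)) p (rotation (\<sigma> p))) n = \<sigma> n"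
proof -
  have p: "p \<ge> 2" using \<open>prime p\<close> by (rule prime_ge_2_nat)
  have ndvd: "\<not> p dvd g ^ i" for i
  proof -
    have "coprime p g" using g by (simp add: residue_primroot_def)
    then show ?thesis
      using \<open>prime p\<close> prime_dvd_power[of p g i] by (auto simp: coprime_absorb_left)
  qed
  have g1: "g \<ge> 1" using ndvd[of 1] by (cases g) auto
  have pow: "\<sigma> (g ^ i) = nat_mult i (\<sigma> g)" for i
    by (rule completely_additive_power[OF add g1])
  \<comment> \<open>By Fermat \<open>g ^ (p - 1)\<close> lies in the class of 1, so the period
    equates its value with \<sigma> 1 = 0.\<close>
  have "[g ^ (p - 1) = g ^ 0] (mod p)"
    unfolding primroot_power_cong_iff[OF \<open>prime p\<close> g] by (simp add: cong_def)
  from per[OF ndvd this] show "nat_mult (p - 1) (\<sigma> g) = 0"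
    by (simp add: pow completely_additive_1[OF add])
  assume "n \<ge> 1"
  show "toeplitz (end_gap_pattern (\<lambda>i. nat_mult (dlog p g i) (\<sigma> g)) p (rotation (\<sigma> p))) n = \<sigma> n"
  proof (rule toeplitz_end_gap_unique[OF p _ _ \<open>n \<ge> 1\<close>])
    fix n :: nat assume "n \<ge> 1"
    then show "\<sigma> (p * n) = rotation (\<sigma> p) \<langle>$\<rangle> (\<sigma> n)"
      using completely_additive_mult[OF add, of p n] p by (simp add: apply_rotation add.commute)
  next
    fix n assume "\<not> p dvd n"
    \<comment> \<open>The period replaces \<open>n\<close> by the congruent power of
      \<open>g\<close>, whose value additivity supplies.\<close>
    from per[OF ndvd power_dlog[OF \<open>prime p\<close> g this]]
    show "\<sigma> n = nat_mult (dlog p g (n mod p)) (\<sigma> g)" by (simp add: pow)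
  qed
qed


subsection \<open>The zero sequence\<close>

lemma sym_headed_one_gap:
  "sym_headed_pattern (map Sym u @ Gap f # map Sym v) \<longleftrightarrow> u \<noteq> []"
  by (cases u) (auto simp: sym_headed_pattern_def)

lemma num_gaps_one_gap: "num_gaps (map Sym u @ Gap f # map Sym v) = 1"
  using num_gaps_map_Sym[of "\<lambda>i. i"] by (simp add: num_gaps_append) (simp add: num_gaps_def)

lemma toeplitz_nth_Sym:
  assumes "sym_headed_pattern P" and "i < length P" and "P ! i = Sym a"
  shows "toeplitz P (Suc i) = a"
  using assms by (intro toeplitz_Sym) simp_all

text \<open>Each letter is 0 or is copied by the identity gap from an earlier position.\<close>

lemma toeplitz_zero_pattern:
  assumes "j \<ge> 1" and P: "P = replicate j (Sym 0) @ [Gap 1] @ replicate l (Sym 0)"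
  shows "sym_headed_pattern P" "num_gaps P = 1" "toeplitz P (Suc n) = 0"
proof -
  have eq: "P = map Sym (replicate j 0) @ Gap 1 # map Sym (replicate l 0)"
    by (simp add: P map_replicate_const)
  show sh: "sym_headed_pattern P" using assms(1) unfolding eq sym_headed_one_gap by auto
  show "num_gaps P = 1" unfolding eq by (rule num_gaps_one_gap)
  show "toeplitz P (Suc n) = 0"
  proof (induction n rule: less_induct)
    case (less n)
    have ne: "P \<noteq> []" by (simp add: P)
    then have "P ! (n mod length P) \<in> set P" by simp
    then have "P ! (n mod length P) = Sym 0 \<or> P ! (n mod length P) = Gap 1"
      by (auto simp: P)
    then have "Stream.cycle P !! n = Sym 0 \<or> Stream.cycle P !! n = Gap 1"
      by (simp add: snth_cycle[OF ne])
    then show ?case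
      using less[OF num_gaps_stake_cycle_less[OF sh]]
      by (auto simp: toeplitz_rec[OF sh, of n])
  qed
qed

text \<open>Only the letter 0 occurs, so a gap counts only through its value at 0; fixing 0 is
  enough to identify it with \<open>Gap 1\<close>.\<close>

lemma toeplitz_zero_imp_identified:
  fixes P :: "'a::zero word"
  assumes sh: "sym_headed_pattern P" and gap: "num_gaps P = 1"
    and zero: "\<And>n. toeplitz P (Suc n) = 0"
  shows "P \<in> identified `` zero_patterns"
proof -
  obtain u f v where P: "P = map Sym u @ Gap f # map Sym v"
    using one_gap_split[OF gap] .
  have "u \<noteq> []" using sh unfolding P sym_headed_one_gap .
  define Z :: "'a word" where
    "Z = replicate (length u) (Sym 0) @ [Gap 1] @ replicate (length v) (Sym 0)"
  have Z: "Z \<in> zero_patterns" and shZ: "sym_headed_pattern Z"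
    using \<open>u \<noteq> []\<close> toeplitz_zero_pattern(1)[of "length u" Z "length v"]
    by (auto simp: Z_def zero_patterns_def Suc_le_eq)
  have letters: "toeplitz_letters Z = {0}"
  proof -
    have "toeplitz Z n = 0" if "n \<ge> 1" for n
      using toeplitz_zero_pattern(3)[of "length u" Z "length v" "n - 1"] \<open>u \<noteq> []\<close> that
      by (simp add: Z_def Suc_le_eq)
    then show ?thesis by (force simp: toeplitz_letters_def)
  qed
  have syms: "P ! i = Sym a \<Longrightarrow> i < length P \<Longrightarrow> a = 0" for i a
    using toeplitz_nth_Sym[OF sh] zero by metis
  \<comment> \<open>At its first occurrence, index \<open>length u\<close>, the gap sends a letter 0
    to a letter 0.\<close>
  have f0: "f \<langle>$\<rangle> 0 = 0"
    using toeplitz_one_gap[OF sh gap, of "length u" f] zero by (simp add: P nth_append)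
  have "list_all2 (same_letter_on {0}) Z P"
  proof (rule list_all2_all_nthI)
    show "length Z = length P" by (simp add: Z_def P)
    fix i assume "i < length Z"
    then have i: "i < length P" by (simp add: Z_def P)
    show "same_letter_on {0} (Z ! i) (P ! i)"
    proof (cases "i = length u")
      case True
      then show ?thesis by (simp add: Z_def P nth_append f0)
    next
      case False
      then have "Z ! i = Sym 0" using i by (auto simp: Z_def P nth_append nth_Cons')
      moreover have "\<exists>a. P ! i = Sym a" using i False by (auto simp: P nth_append nth_Cons')
      ultimately show ?thesis using syms[OF _ i] by auto
    qed
  qed
  then have "(Z, P) \<in> identified" using sh shZ letters by (simp add: identified_def)
  then show ?thesis using Z by blast
qed


subsection \<open>The classification\<close>

lemma identified_num_gaps:
  assumes "(P, Q) \<in> identified"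
  shows "num_gaps P = num_gaps Q"
proof -
  have "list_all2 (same_letter_on (toeplitz_letters P)) P Q"
    using assms by (simp add: identified_def)
  then show ?thesis
  proof (induction rule: list_all2_induct)
    case (Cons x xs y ys)
    then show ?case by (cases x; cases y) (auto simp: num_gaps_def)
  qed simp
qed

text \<open>Word and gap count survive identification. Hence the set is a union of classes and can
  equal an image under \<open>identified\<close>.\<close>

lemma additive_one_gap_identified:
  assumes "P \<in> additive_one_gap_patterns" and "(P, Q) \<in> identified"
  shows "Q \<in> additive_one_gap_patterns"
proof -
  have "toeplitz Q n = toeplitz P n" if "n \<ge> 1" for n
    using identified_toeplitz[OF assms(2), of "n - 1"] that by simp
  moreover have "completely_additive (toeplitz P)"
    using assms(1) by (simp add: additive_one_gap_patterns_def)
  ultimately have "completely_additive (toeplitz Q)"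
    by (metis completely_additive_cong)
  then show ?thesis
    using assms identified_num_gaps[OF assms(2)]
    by (auto simp: additive_one_gap_patterns_def identified_def)
qed

section \<open>From the listed patterns to complete additivity\<close>

lemma log_patterns_additive:
  fixes g :: "nat \<Rightarrow> nat"
  assumes "\<And>p. prime p \<Longrightarrow> residue_primroot p (g p)"
  shows "log_patterns g \<subseteq> (additive_one_gap_patterns :: 'k::finite mod_ring word set)"
proof
  fix P :: "'k mod_ring word" assume "P \<in> log_patterns g"
  then obtain p k c d where pk: "prime p" "k \<ge> 1"
    and c: "nat_mult (p - 1) c = 0"
    and P: "P = pattern_power (scale_word (lambda_word p (g p)) c @ [Gap (rotation d)]) k"
    unfolding log_patterns_def nat_mult_eq_0_iff[symmetric] by blast
  have p: "p \<ge> 2" using pk(1) by (rule prime_ge_2_nat)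
  have "p ^ 1 \<le> p ^ k" using p pk(2) by (intro power_increasing) auto
  then have "p ^ k \<ge> 2" using p by simp
  then have "sym_headed_pattern P" "num_gaps P = 1"
    unfolding P log_pattern_eq_end_gap pattern_power_end_gap[OF p]
    by (simp_all add: sym_headed_end_gap_pattern num_gaps_end_gap_pattern)
  moreover have "completely_additive (toeplitz P)"
    unfolding P log_pattern_eq_end_gap
    by (rule completely_additive_cong[OF completely_additive_log_pattern[OF pk(1) assms[OF pk(1)] c]
          toeplitz_pattern_power[OF p pk(2)]])
  ultimately show "P \<in> additive_one_gap_patterns" by (simp add: additive_one_gap_patterns_def)
qed

lemma zero_patterns_additive: "zero_patterns \<subseteq> additive_one_gap_patterns"
proof
  fix P :: "'a word" assume "P \<in> zero_patterns"
  then obtain j l where j: "j \<ge> 1" and P: "P = replicate j (Sym 0) @ [Gap 1] @ replicate l (Sym 0)"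
    unfolding zero_patterns_def by blast
  note Z = toeplitz_zero_pattern[OF j P]
  have "toeplitz P n = 0" if "n \<ge> 1" for n using Z(3)[of "n - 1"] that by simp
  then have "completely_additive (toeplitz P)" by (simp add: completely_additive_def)
  then show "P \<in> additive_one_gap_patterns" using Z by (simp add: additive_one_gap_patterns_def)
qed

section \<open>From complete additivity to the listed patterns\<close>

lemma last_Sym_imp_zero:
  fixes P :: "'a::cancel_comm_monoid_add word"
  assumes sh: "sym_headed_pattern P" and add: "completely_additive (toeplitz P)"
    and P: "P = Q @ [Sym a]"
  shows "toeplitz P (Suc n) = 0"
proof -
  let ?r = "length P"
  have last: "toeplitz P (?r * Suc n) = a" for n
  proof -
    have "(n * ?r + (?r - 1)) mod ?r = ?r - 1" by (intro mult_add_div_mod) (simp add: P)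
    then have "toeplitz P (Suc (n * ?r + (?r - 1))) = a"
      by (intro toeplitz_Sym[OF sh]) (simp only:, simp add: P)
    moreover have "Suc (n * ?r + (?r - 1)) = ?r * Suc n" by (simp add: P)
    ultimately show ?thesis by (simp only:)
  qed
  \<comment> \<open>All multiples of \<open>?r\<close> carry the letter \<open>a\<close>; expanding
    two of them by additivity lets the value at \<open>?r\<close> cancel.\<close>
  have "toeplitz P (?r * Suc n) = toeplitz P (?r * Suc 0)" by (simp only: last)
  moreover have "?r \<ge> 1" by (simp add: P)
  ultimately have "toeplitz P ?r + toeplitz P (Suc n) = toeplitz P ?r + toeplitz P (Suc 0)"
    using completely_additive_mult[OF add, of ?r] by (simp del: mult_Suc_right)
  then show ?thesis using completely_additive_1[OF add] by simp
qed

lemma end_gap_cases: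
  fixes g :: "nat \<Rightarrow> nat" and P :: "'k::finite mod_ring word"
  assumes g: "\<And>p. prime p \<Longrightarrow> residue_primroot p (g p)"
    and add: "completely_additive (toeplitz P)"
    and P: "P = end_gap_pattern \<tau> r f" and r: "r \<ge> 2"
  shows "P \<in> identified `` log_patterns g \<or> (\<forall>n. toeplitz P (Suc n) = 0)"
proof -
  define \<sigma> where "\<sigma> = toeplitz P"
  have add: "completely_additive \<sigma>" using add by (simp add: \<sigma>_def)
  have "\<sigma> (n mod r) = \<sigma> n" if "\<not> r dvd n" for n
    using toeplitz_end_gap_mod_power[OF r, of 1 n \<tau> f] that by (simp add: \<sigma>_def P)
  \<comment> \<open>The descended period is used at prime divisors of \<open>r\<close>: one for a
    prime power, two different ones otherwise.\<close>
  then have per: "\<sigma> n = \<sigma> m" if "s dvd r" "\<not> s dvd n" "[n = m] (mod s)" for s n m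
    using period_descends[OF add _ _ that] r by simp
  from r show ?thesis
  proof (cases rule: prime_power_or_two_primes)
    case (two p q)
    have "\<sigma> n = 0" if "n \<ge> 1" for n
      by (rule two_prime_periods_imp_zero[OF add two(1-3) per[OF two(4)] per[OF two(5)] that])
    then show ?thesis by (simp add: \<sigma>_def)
  next
    case (power p k)
    have p: "p \<ge> 2" using power(1) by (rule prime_ge_2_nat)
    have "p dvd r" using power by simp
    note log = prime_period_imp_log_pattern[OF add power(1) g[OF power(1)]]
    have c: "nat_mult (p - 1) (\<sigma> (g p)) = 0" by (rule log(1)[OF per[OF \<open>p dvd r\<close>]])
    \<comment> \<open>\<open>Q\<close> has length \<open>p\<close> and its data are read off from
      \<sigma> at \<open>g p\<close> and \<open>p\<close>, so its word is \<sigma>; its power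
      \<open>k\<close> then has the length of \<open>P\<close>.\<close>
    define Q where
      "Q = end_gap_pattern (\<lambda>i. nat_mult (dlog p (g p) i) (\<sigma> (g p))) p (rotation (\<sigma> p))"
    have Q: "toeplitz Q n = \<sigma> n" if "n \<ge> 1" for n
      unfolding Q_def by (rule log(2)[OF per[OF \<open>p dvd r\<close>] that])
    have "pattern_power Q k \<in> log_patterns g"
      using power(1,2) c
      unfolding log_patterns_def Q_def log_pattern_eq_end_gap nat_mult_eq_0_iff[symmetric] by blast
    moreover have "(pattern_power Q k, P) \<in> identified"
    proof -
      have Qk: "pattern_power Q k = end_gap_pattern \<sigma> r (rotation (\<sigma> p) ^ k)"
        unfolding Q_def pattern_power_end_gap[OF p] power(3)[symmetric]
        by (rule end_gap_pattern_cong) (use Q in \<open>simp add: Q_def\<close>)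
      have P': "P = end_gap_pattern \<sigma> r f"
        unfolding \<sigma>_def P end_gap_pattern_toeplitz[OF r] ..
      \<comment> \<open>The two gaps may differ as bijections, but both send \<sigma>
        \<open>n\<close> to \<sigma> \<open>(r * n)\<close>, so they agree on every occurring
        letter.\<close>
      have "(rotation (\<sigma> p) ^ k) \<langle>$\<rangle> a = f \<langle>$\<rangle> a" if a: "a \<in> toeplitz_letters (pattern_power Q k)" for a
      proof -
        obtain n where n: "n \<ge> 1" and "a = toeplitz (pattern_power Q k) n"
          using a by (auto simp: toeplitz_letters_def)
        then have a: "a = \<sigma> n"
          using Q[OF n] by (simp add: Q_def toeplitz_pattern_power[OF p power(2) n])
        have "(rotation (\<sigma> p) ^ k) \<langle>$\<rangle> (\<sigma> n) = \<sigma> (r * n)"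
          using toeplitz_end_gap_mult_power[OF p n, of _ "rotation (\<sigma> p)" k] Q[OF n] Q[of "r * n"] n r
          by (simp add: Q_def power(3))
        also have "\<dots> = f \<langle>$\<rangle> (\<sigma> n)"
          using toeplitz_end_gap_mult[OF r n] by (simp add: \<sigma>_def P)
        finally show ?thesis by (simp add: a)
      qed
      then have "list_all2 (same_letter_on (toeplitz_letters (pattern_power Q k))) (pattern_power Q k) P"
        unfolding P' by (subst (2) Qk)
          (auto simp: end_gap_pattern_def list_all2_conv_all_nth nth_append)
      then show ?thesis
        by (simp add: identified_def P Qk sym_headed_end_gap_pattern[OF r])
    qed
    ultimately show ?thesis by blast
  qed
qed

theorem mainTheorem1:
  fixes g :: "nat \<Rightarrow> nat"
  assumes "\<And>p. prime p \<Longrightarrow> residue_primroot p (g p)"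
    and "g 2 = 1"
  shows "(additive_one_gap_patterns :: 'k::finite mod_ring word set) =
         identified `` (log_patterns g \<union> zero_patterns)"
proof
  show "identified `` (log_patterns g \<union> zero_patterns)
      \<subseteq> (additive_one_gap_patterns :: 'k mod_ring word set)"
    using log_patterns_additive[OF assms(1)] zero_patterns_additive additive_one_gap_identified
    by blast
  show "(additive_one_gap_patterns :: 'k mod_ring word set)
      \<subseteq> identified `` (log_patterns g \<union> zero_patterns)"
  proof
    fix P :: "'k mod_ring word" assume "P \<in> additive_one_gap_patterns"
    then have sh: "sym_headed_pattern P" and gap: "num_gaps P = 1"
      and add: "completely_additive (toeplitz P)"
      by (auto simp: additive_one_gap_patterns_def)
    obtain u f v where P: "P = map Sym u @ Gap f # map Sym v"
      using one_gap_split[OF gap] .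
    have "P \<in> identified `` log_patterns g \<or> (\<forall>n. toeplitz P (Suc n) = 0)"
    proof (cases v rule: rev_cases)
      case Nil
      \<comment> \<open>The list \<open>u\<close> is indexed from 0, positions in the word from
        1.\<close>
      define \<tau> where "\<tau> = (\<lambda>i. u ! (i - 1))"
      have "map Sym u = map (\<lambda>i. Sym (\<tau> i)) [1..<Suc (length u)]"
        by (rule nth_equalityI) (simp_all add: \<tau>_def del: upt_Suc)
      then have "P = end_gap_pattern \<tau> (Suc (length u)) f"
        by (simp add: P Nil end_gap_pattern_def del: upt_Suc)
      moreover have "Suc (length u) \<ge> 2"
        using sh unfolding P sym_headed_one_gap by (cases u) auto
      ultimately show ?thesis using end_gap_cases[OF assms(1) add] by blast
    next
      case (snoc v' a)
      then have "P = (map Sym u @ Gap f # map Sym v') @ [Sym a]" by (simp add: P)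
      from last_Sym_imp_zero[OF sh add this] show ?thesis by blast
    qed
    \<comment> \<open>A vanishing word, from either case, places \<open>P\<close> in the class of
      the zero pattern of the same shape.\<close>
    then show "P \<in> identified `` (log_patterns g \<union> zero_patterns)"
      using toeplitz_zero_imp_identified[OF sh gap] by blast
  qed
qed

end
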